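(* Let $(Y,\|\cdot\|)$ be a nonzero Banach space and $K\subseteq Y$ a closed, convex and pointed cone with nonempty interior. Suppose in addition that $\operatorname{int}(K^* )\neq\emptyset$. Then $\Omega_{QD}\setminus\Omega_{DS}\neq\emptyset$.
   Context: Spaces are real; $Y^*$ is the topological dual with dual norm. A cone is a set $C$ with $tx\in C$ for all $x\in C$, $t\ge 0$. $K^*=\{y^*\in Y^*:\langle y^*,y\rangle\ge 0\ \forall y\in K\}$; $\operatorname{int}$ of a subset of $Y^*$ is the norm interior. For $A\subseteq Y^*$, $\sigma_A(y):=\sup_{y^*\in A}\langle y^*,y\rangle$, and for $y\in Y$ the $y$-face of $A$ is $A^y:=\{y^*\in A:\langle y^*,y\rangle=\sigma_A(y)\}$. For $A,B\subseteq Y^*$: $A\preceq_l^{K^*}B$ iff $B\subseteq A+K^*$; $A\preceq_u^{K^*}B$ iff $A\subseteq B-K^*$; $A\preceq_s^{K^*}B$ iff both hold. For $y\in Y$, $P(y):=\{y^*\in Y^*:\langle y^*,y\rangle\ge 0\}$. For nonempty convex $w^*$-compact $G,H\subseteq Y^*$, the pair $[G,H]$ is a scalarization pair, written $[G,H]\in\mathbb{S}(K)$, if (i) $H^y\preceq_s^{K^*}G^y$ for every $y\in Y$; (ii) $H\cap G=\emptyset$; (iii) $H\subseteq\bigcap_{y\notin -K}\left(G-\operatorname{int}(P(y))\right)$. $\Omega_{QD}:=\{\Psi:Y\to\mathbb{R}\ :\ \exists\,[G,H]\in\mathbb{S}(K)\text{ with }\Psi=\sigma_G-\sigma_H\}$.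 $\Omega_{DS}$ is the set of all functionals $\Psi_G=\sigma_G$, where $G$ ranges over the $w^*$-compact generators of $K^*$; $G\subseteq Y^*$ is a generator of $K^*$ if $G$ is convex, $0$ is not in the $w^*$-closure of $G$, and $K^*=\{ty^*:t\ge 0,\ y^*\in G\}$. *)

theory Defs
  imports "HOL-Analysis.Analysis"
begin

type_synonym 'a dual = "'a \<Rightarrow>\<^sub>L real"

(* For real-valued bounded operators, the strong operator topology (pointwise convergence)
   is exactly the weak-star topology of the dual. *)
abbreviation weak_star :: "('a::real_normed_vector) dual topology"
  where "weak_star \<equiv> strong_operator_topology"

definition dual_cone :: "'a::real_normed_vector set \<Rightarrow> 'a dual set"
  where "dual_cone K = {f. \<forall>y\<in>K. blinfun_apply f y \<ge> 0}"

(* Real-valued supremum: meaningful for nonempty pointwise bounded A, in particular for the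
   nonempty weak-star compact sets to which it is applied below. *)
definition supp_fun :: "'a::real_normed_vector dual set \<Rightarrow> 'a \<Rightarrow> real"
  where "supp_fun A y = (SUP f\<in>A. blinfun_apply f y)"

definition face :: "'a::real_normed_vector dual set \<Rightarrow> 'a \<Rightarrow> 'a dual set"
  where "face A y = {f \<in> A. blinfun_apply f y = supp_fun A y}"

(* A + B is the Minkowski sum of HOL-Library.Set_Algebras.  As A - B on sets is the set
   difference, the Minkowski difference is written with the pointwise image uminus ` B. *)
definition lower_less :: "'b::real_vector set \<Rightarrow> 'b set \<Rightarrow> 'b set \<Rightarrow> bool"
  where "lower_less C A B \<longleftrightarrow> B \<subseteq> A + C"

definition upper_less :: "'b::real_vector set \<Rightarrow> 'b set \<Rightarrow> 'b set \<Rightarrow> bool"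
  where "upper_less C A B \<longleftrightarrow> A \<subseteq> B + uminus ` C"

definition set_less :: "'b::real_vector set \<Rightarrow> 'b set \<Rightarrow> 'b set \<Rightarrow> bool"
  where "set_less C A B \<longleftrightarrow> lower_less C A B \<and> upper_less C A B"

definition pos_halfspace :: "'a::real_normed_vector \<Rightarrow> 'a dual set"
  where "pos_halfspace y = {f. blinfun_apply f y \<ge> 0}"

(* interior is taken in the norm topology of the dual *)
definition scalarization_pair ::
    "'a::real_normed_vector set \<Rightarrow> 'a dual set \<Rightarrow> 'a dual set \<Rightarrow> bool"
  where "scalarization_pair K G H \<longleftrightarrow>
    G \<noteq> {} \<and> convex G \<and> compactin weak_star G \<and>
    H \<noteq> {} \<and> convex H \<and> compactin weak_star H \<and>
    (\<forall>y. set_less (dual_cone K) (face H y) (face G y)) \<and>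
    H \<inter> G = {} \<and>
    H \<subseteq> (\<Inter>y\<in>- (uminus ` K). G + uminus ` interior (pos_halfspace y))"

definition Omega_QD :: "'a::real_normed_vector set \<Rightarrow> ('a \<Rightarrow> real) set"
  where "Omega_QD K =
    {\<Psi>. \<exists>G H. scalarization_pair K G H \<and> \<Psi> = (\<lambda>y. supp_fun G y - supp_fun H y)}"

definition generator :: "'a::real_normed_vector set \<Rightarrow> 'a dual set \<Rightarrow> bool"
  where "generator K G \<longleftrightarrow>
    convex G \<and> 0 \<notin> weak_star closure_of G \<and>
    dual_cone K = {t *\<^sub>R f | t f. t \<ge> 0 \<and> f \<in> G}"

definition Omega_DS :: "'a::real_normed_vector set \<Rightarrow> ('a \<Rightarrow> real) set"
  where "Omega_DS K = {\<Psi>. \<exists>G. compactin weak_star G \<and> generator K G \<and> \<Psi> = supp_fun G}"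

definition pointed :: "'a::real_vector set \<Rightarrow> bool"
  where "pointed K \<longleftrightarrow> K \<inter> uminus ` K = {0}"

end

(* Fix e in the interior of K; then {f in K* : f(e) = 1} is a w*-compact base of K*. Take
   G = {f in K* : f(e) = 2}, H = {f in K* : f(e) \<le> 1} and Psi = sigma_G - sigma_H. Then
   Psi(e) = 2 - 1 and Psi(-e) = -2 - 0, so Psi(e) + Psi(-e) < 0, which is impossible for the
   support function of a nonempty set. Condition (iii) needs, for y outside -K, an f in K* with
   f(e) = 1 and f(y) > 0. It comes from a linear functional below the gauge
   x |-> inf {t. t e - x in K}, obtained as a minimal sublinear functional. *)
theory Submission
  imports Defs
begin

section \<open>Sublinear functionals and Hahn-Banach by minimality\<close>

definition sublinear :: "('a::real_vector \<Rightarrow> real) \<Rightarrow> bool"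
  where "sublinear q \<longleftrightarrow>
    (\<forall>x y. q (x + y) \<le> q x + q y) \<and> (\<forall>c\<ge>0. \<forall>x. q (c *\<^sub>R x) \<le> c * q x)"

lemma sublinear_add: "sublinear q \<Longrightarrow> q (x + y) \<le> q x + q y"
  by (simp add: sublinear_def)

lemma sublinear_scale_le: "sublinear q \<Longrightarrow> c \<ge> 0 \<Longrightarrow> q (c *\<^sub>R x) \<le> c * q x"
  by (simp add: sublinear_def)

lemma sublinear_zero: "sublinear q \<Longrightarrow> q 0 = 0"
  using sublinear_add[of q 0 0] sublinear_scale_le[of q 0 0] by simp

text \<open>Applying the inequality to \<open>inverse c\<close> at the point
  \<open>c *\<^sub>R x\<close> reverses it. So the definition can ask for one direction only, which
  is what passes easily to infima.\<close>

lemma sublinear_scale: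
  assumes "sublinear q" "c \<ge> 0"
  shows "q (c *\<^sub>R x) = c * q x"
proof (cases "c = 0")
  case False
  with assms have "c > 0" by simp
  have "q x \<le> inverse c * q (c *\<^sub>R x)"
    using sublinear_scale_le[OF assms(1), of "inverse c" "c *\<^sub>R x"] \<open>c > 0\<close> by simp
  then have "c * q x \<le> q (c *\<^sub>R x)"
    using \<open>c > 0\<close> by (simp add: field_simps)
  then show ?thesis using sublinear_scale_le[OF assms] by (simp add: antisym)
qed (use assms in \<open>simp add: sublinear_zero\<close>)

lemma sublinear_neg_le: "sublinear q \<Longrightarrow> - q (- x) \<le> q x"
  using sublinear_add[of q x "- x"] sublinear_zero[of q] by simp

text \<open>The single \<open>F i\<close> need not be sublinear: it is enough that sums and
  multiples of their values are dominated by some other member of the family. This covers both the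
  shifted functionals of \<open>sublinear_directional\<close> and chains in Zorn's lemma.\<close>

lemma sublinear_INF:
  fixes F :: "'i \<Rightarrow> 'a::real_vector \<Rightarrow> real"
  assumes ne: "I \<noteq> {}"
    and bdd: "\<And>x. bdd_below ((\<lambda>i. F i x) ` I)"
    and add: "\<And>i j x y. i \<in> I \<Longrightarrow> j \<in> I \<Longrightarrow> \<exists>k\<in>I. F k (x + y) \<le> F i x + F j y"
    and scale: "\<And>i c x. i \<in> I \<Longrightarrow> c \<ge> 0 \<Longrightarrow> \<exists>k\<in>I. F k (c *\<^sub>R x) \<le> c * F i x"
  shows "sublinear (\<lambda>x. INF i\<in>I. F i x)"
proof -
  define q where "q x = (INF i\<in>I. F i x)" for x
  have lower: "q x \<le> F i x" if "i \<in> I" for i x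
    unfolding q_def by (rule cINF_lower[OF bdd that])
  have greatest: "m \<le> q x" if "\<And>i. i \<in> I \<Longrightarrow> m \<le> F i x" for m x
    unfolding q_def by (rule cINF_greatest[OF ne that])
  have "q (x + y) \<le> q x + q y" for x y
  proof -
    have "q (x + y) - F i x \<le> F j y" if "i \<in> I" "j \<in> I" for i j
      using add[OF that, of x y] lower[of _ "x + y"] by fastforce
    then have "q (x + y) - F i x \<le> q y" if "i \<in> I" for i
      using that by (intro greatest)
    then have "q (x + y) - q y \<le> q x"
      by (intro greatest) (simp add: algebra_simps)
    then show ?thesis by simp
  qed
  moreover have "q (c *\<^sub>R x) \<le> c * q x" if "c \<ge> 0" for c x
  proof -
    have le: "q (c *\<^sub>R x) \<le> c * F i x" if "i \<in> I" for i
      using scale[OF that \<open>c \<ge> 0\<close>, of x] lower[of _ "c *\<^sub>R x"] by fastforce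
    show ?thesis
    proof (cases "c = 0")
      case True
      then show ?thesis using le ne by auto
    next
      case False
      then have "c > 0" using that by simp
      have "q (c *\<^sub>R x) / c \<le> q x"
        using le \<open>c > 0\<close> by (intro greatest) (simp add: field_simps)
      then show ?thesis using \<open>c > 0\<close> by (simp add: field_simps)
    qed
  qed
  ultimately show ?thesis unfolding sublinear_def q_def by simp
qed

text \<open>The witness is the infimum over s >= 0 of q(x + s y) - s q(y): s = 0 puts it below q,
  and s = 1 at -y gives q(0) - q(y) = -q(y). It serves twice below, to force a value at one point
  and to show that minimal functionals are odd.\<close>

lemma sublinear_directional:
  assumes q: "sublinear q"
  obtains q' where "sublinear q'" "\<And>x. q' x \<le> q x" "q' (- y) \<le> - q y"
proof
  define F where "F s x = q (x + s *\<^sub>R y) - s * q y" for s x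
  define q' where "q' x = (INF s\<in>{0..}. F s x)" for x
  \<comment> \<open>A bound uniform in s keeps the infimum finite: s q(y) = q(s y) <= q(-x) + q(x +
    s y).\<close>
  have below: "- q (- x) \<le> F s x" if "s \<ge> 0" for s x
    using sublinear_add[OF q, of "- x" "x + s *\<^sub>R y"] sublinear_scale[OF q that, of y]
    by (simp add: F_def)
  have bdd: "bdd_below ((\<lambda>s. F s x) ` {0..})" for x
    using below by (auto intro!: bdd_belowI2[where m = "- q (- x)"])
  have lower: "q' x \<le> F s x" if "s \<ge> 0" for s x
    unfolding q'_def using that by (intro cINF_lower[OF bdd]) simp
  show "sublinear q'"
    unfolding q'_def
  proof (rule sublinear_INF[OF _ bdd])
    fix i j :: real and x z :: 'a
    assume "i \<in> {0..}" "j \<in> {0..}"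
    moreover have "F (i + j) (x + z) \<le> F i x + F j z"
      using sublinear_add[OF q, of "x + i *\<^sub>R y" "z + j *\<^sub>R y"]
      by (simp add: F_def algebra_simps)
    ultimately show "\<exists>k\<in>{0..}. F k (x + z) \<le> F i x + F j z"
      by (intro bexI[of _ "i + j"]) auto
  next
    fix i c :: real and x :: 'a
    assume "i \<in> {0..}" "c \<ge> 0"
    moreover have "F (c * i) (c *\<^sub>R x) \<le> c * F i x"
      using sublinear_scale_le[OF q \<open>c \<ge> 0\<close>, of "x + i *\<^sub>R y"]
      by (simp add: F_def algebra_simps)
    ultimately show "\<exists>k\<in>{0..}. F k (c *\<^sub>R x) \<le> c * F i x"
      by (intro bexI[of _ "c * i"]) auto
  qed simp
  show "q' x \<le> q x" for x
    using lower[of 0 x] by (simp add: F_def)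
  show "q' (- y) \<le> - q y"
    using lower[of 1 "- y"] by (simp add: F_def sublinear_zero[OF q])
qed

lemma sublinear_minimal_exists:
  assumes p: "sublinear p"
  obtains m where "sublinear m" "\<And>x. m x \<le> p x"
    "\<And>q. sublinear q \<Longrightarrow> (\<And>x. q x \<le> m x) \<Longrightarrow> q = m"
proof -
  define A where "A = {q. sublinear q \<and> q \<le> p}"
  \<comment> \<open>The order is reversed, so that the maximal elements of Zorn's lemma are the
    minimal sublinear minorants of p.\<close>
  define P :: "('a \<Rightarrow> real) \<Rightarrow> ('a \<Rightarrow> real) \<Rightarrow> bool" where "P = (\<lambda>q r. r \<le> q)"
  have "partial_order_on A (relation_of P A)"
    by (auto simp: partial_order_on_def preorder_on_def refl_on_def trans_def antisym_def
        relation_of_def P_def)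
  moreover have "\<exists>u\<in>A. \<forall>a\<in>C. P a u" if "C \<in> Chains (relation_of P A)" for C
  proof (cases "C = {}")
    case True
    then show ?thesis using p by (auto simp: A_def)
  next
    case False
    have CA: "C \<subseteq> A" and tot: "\<And>a b. a \<in> C \<Longrightarrow> b \<in> C \<Longrightarrow> a \<le> b \<or> b \<le> a"
      using that unfolding Chains_def relation_of_def P_def by auto
    have subl: "sublinear a" if "a \<in> C" for a using CA that by (auto simp: A_def)
    \<comment> \<open>All minorants share one pointwise lower bound, because -p(-x) <= -a(-x) <=
      a(x); hence the infimum of a chain is real-valued.\<close>
    have below: "- p (- x) \<le> a x" if "a \<in> C" for a x
    proof -
      have "a (- x) \<le> p (- x)" using CA that by (auto simp: A_def le_fun_def)
      then show ?thesis using sublinear_neg_le[OF subl[OF that], of x] by simp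
    qed
    have bdd: "bdd_below ((\<lambda>a. a x) ` C)" for x
      using below by (auto intro!: bdd_belowI2[where m = "- p (- x)"])
    define u where "u x = (INF a\<in>C. a x)" for x
    have lower: "u x \<le> a x" if "a \<in> C" for a x
      unfolding u_def by (rule cINF_lower[OF bdd that])
    have "sublinear u"
      unfolding u_def
    proof (rule sublinear_INF[OF False bdd])
      fix a b x y assume ab: "a \<in> C" "b \<in> C"
      \<comment> \<open>In a chain the smaller of the two functionals can be used at both points,
        and its own subadditivity applies.\<close>
      then consider "a \<le> b" | "b \<le> a" using tot by blast
      then show "\<exists>k\<in>C. k (x + y) \<le> a x + b y"
      proof cases
        case 1
        then have "a (x + y) \<le> a x + b y"
          using sublinear_add[OF subl[OF ab(1)], of x y] le_funD[OF 1, of y] by simp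
        then show ?thesis using ab by blast
      next
        case 2
        then have "b (x + y) \<le> a x + b y"
          using sublinear_add[OF subl[OF ab(2)], of x y] le_funD[OF 2, of x] by simp
        then show ?thesis using ab by blast
      qed
    qed (use subl sublinear_scale_le in blast)
    moreover have "u \<le> p"
    proof -
      obtain a where "a \<in> C" using False by blast
      then have "u \<le> a" "a \<le> p" using lower CA by (auto simp: A_def le_fun_def)
      then show ?thesis by (rule order_trans)
    qed
    ultimately show ?thesis
      using lower by (intro bexI[of _ u]) (auto simp: A_def P_def le_fun_def)
  qed
  ultimately obtain m where m: "m \<in> A" "\<And>a. a \<in> A \<Longrightarrow> a \<le> m \<Longrightarrow> a = m"
    using predicate_Zorn[of A P] unfolding P_def by blast
  show ?thesis
  proof (rule that[of m])
    show "q = m" if "sublinear q" "\<And>x. q x \<le> m x" for q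
      using that m(1) by (intro m(2)) (auto simp: A_def le_fun_def intro: order_trans)
  qed (use m(1) in \<open>auto simp: A_def le_fun_def\<close>)
qed

text \<open>A minimal sublinear functional f is linear: \<open>sublinear_directional\<close> gives a
  minorant h of f with h(-x) <= -f(x), and minimality makes h = f, so f is odd. Minimizing below a q
  with q(-y) <= -p(y), rather than below p itself, fixes the value at y.\<close>

lemma Hahn_Banach_sublinear:
  fixes p :: "'a::real_vector \<Rightarrow> real"
  assumes p: "sublinear p"
  obtains f where "linear f" "\<And>x. f x \<le> p x" "f y = p y"
proof -
  obtain q where q: "sublinear q" "\<And>x. q x \<le> p x" "q (- y) \<le> - p y"
    using sublinear_directional[OF p] by blast
  obtain f where f: "sublinear f" "\<And>x. f x \<le> q x"
    and min: "\<And>h. sublinear h \<Longrightarrow> (\<And>x. h x \<le> f x) \<Longrightarrow> h = f"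
    using sublinear_minimal_exists[OF q(1)] by blast
  have neg: "f (- x) = - f x" for x
  proof -
    obtain h where "sublinear h" "\<And>z. h z \<le> f z" "h (- x) \<le> - f x"
      using sublinear_directional[OF f(1)] by blast
    with min have "f (- x) \<le> - f x" by blast
    then show ?thesis using sublinear_neg_le[OF f(1), of x] by simp
  qed
  show ?thesis
  proof
    show "linear f"
    proof
      show "f (x + z) = f x + f z" for x z
        using sublinear_add[OF f(1), of x z] sublinear_add[OF f(1), of "- x" "- z"]
          neg[of x] neg[of z] neg[of "x + z"] by simp
      show "f (c *\<^sub>R x) = c *\<^sub>R f x" for c x
      proof (cases "c \<ge> 0")
        case True
        then show ?thesis by (simp add: sublinear_scale[OF f(1)])
      next
        case False
        then show ?thesis
          using sublinear_scale[OF f(1), of "- c" x] neg[of "c *\<^sub>R x"] by simp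
      qed
    qed
    show le: "f x \<le> p x" for x using f(2) q(2) order_trans by blast
    show "f y = p y"
      using f(2)[of "- y"] q(3) neg[of y] le[of y] by simp
  qed
qed

section \<open>Support functions and faces of weak-star compact sets\<close>

lemma compactin_weak_star_evaluation:
  assumes "compactin weak_star A"
  shows "compact ((\<lambda>f. blinfun_apply f y) ` A)"
  using image_compactin[OF assms strong_operator_topology_continuous_evaluation[of y]] by simp

lemma supp_fun_upper:
  assumes "compactin weak_star A" "f \<in> A"
  shows "blinfun_apply f y \<le> supp_fun A y"
  unfolding supp_fun_def
  using compactin_weak_star_evaluation[OF assms(1), of y] assms(2)
  by (intro cSUP_upper bounded_imp_bdd_above compact_imp_bounded)

lemma supp_fun_eqI:
  assumes "f \<in> A" "\<And>g. g \<in> A \<Longrightarrow> blinfun_apply g y \<le> blinfun_apply f y"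
  shows "supp_fun A y = blinfun_apply f y"
  unfolding supp_fun_def using assms by (intro cSup_eq_maximum) auto

text \<open>Compactness bounds the values at y, so the real-valued supremum is a genuine upper
  bound. Faces can then be handled as sets of maximizers, without mentioning suprema.\<close>

lemma face_eq:
  assumes "compactin weak_star A"
  shows "face A y = {f \<in> A. \<forall>g\<in>A. blinfun_apply g y \<le> blinfun_apply f y}"
proof (intro set_eqI iffI)
  fix f assume "f \<in> face A y"
  then show "f \<in> {f \<in> A. \<forall>g\<in>A. blinfun_apply g y \<le> blinfun_apply f y}"
    using supp_fun_upper[OF assms] by (simp add: face_def)
next
  fix f assume "f \<in> {f \<in> A. \<forall>g\<in>A. blinfun_apply g y \<le> blinfun_apply f y}"
  then show "f \<in> face A y"
    using supp_fun_eqI[of f A y] by (simp add: face_def)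
qed

lemma face_nonempty:
  assumes "compactin weak_star A" "A \<noteq> {}"
  shows "face A y \<noteq> {}"
  using compact_attains_sup[OF compactin_weak_star_evaluation[OF assms(1), of y]] assms(2)
  unfolding face_eq[OF assms(1)] by auto

section \<open>Cones with an order unit, and the gauge of the unit\<close>

text \<open>The centre e of a ball inside K acts as order unit. Pointedness and the nonzero space
  enter through \<open>neg_unit\<close>, which keeps K from being the whole space.\<close>

locale solid_cone =
  fixes K :: "'a::real_normed_vector set" and e :: 'a and r :: real
  assumes closed: "closed K"
    and add: "\<And>x y. x \<in> K \<Longrightarrow> y \<in> K \<Longrightarrow> x + y \<in> K"
    and scale: "\<And>x c. x \<in> K \<Longrightarrow> c \<ge> 0 \<Longrightarrow> c *\<^sub>R x \<in> K"
    and r: "r > 0" "cball e r \<subseteq> K"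
    and neg_unit: "- e \<notin> K"
begin

lemma unit_in: "e \<in> K"
  using r by auto

text \<open>For nonzero x the point e + (r / norm x) x lies in the ball around e; multiply it by
  norm x / r.\<close>

lemma absorbing: "(norm x / r) *\<^sub>R e + x \<in> K"
proof (cases "x = 0")
  case False
  have "e + (r / norm x) *\<^sub>R x \<in> K"
    using r False by (intro subsetD[OF r(2)]) (simp add: dist_norm)
  then have "(norm x / r) *\<^sub>R (e + (r / norm x) *\<^sub>R x) \<in> K"
    using r by (intro scale) auto
  then show ?thesis using r False by (simp add: scaleR_add_right)
qed (use scale[OF unit_in, of 0] in simp)

text \<open>Positivity alone forces continuity: evaluate f at the points that
  \<open>absorbing\<close> supplies for x and for -x. This applies to the Hahn-Banach functional
  before it is known to be bounded.\<close>

lemma positive_functional_bound: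
  assumes "linear f" "\<And>x. x \<in> K \<Longrightarrow> f x \<ge> (0::real)"
  shows "\<bar>f x\<bar> \<le> f e * norm x / r"
proof -
  have "(norm x / r) * f e + f x \<ge> 0"
    using assms(2)[OF absorbing[of x]]
    by (simp add: linear_add[OF assms(1)] linear_scale[OF assms(1)])
  moreover have "(norm x / r) * f e - f x \<ge> 0"
    using assms(2)[OF absorbing[of "- x"]]
    by (simp add: linear_diff[OF assms(1)] linear_scale[OF assms(1)])
  moreover have "(norm x / r) * f e = f e * norm x / r" by simp
  ultimately show ?thesis by linarith
qed

definition order_gauge :: "'a \<Rightarrow> real"
  where "order_gauge x = Inf {t. t *\<^sub>R e - x \<in> K}"

lemma unit_scale_in_iff: "t *\<^sub>R e \<in> K \<longleftrightarrow> t \<ge> 0"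
proof
  assume *: "t *\<^sub>R e \<in> K"
  show "t \<ge> 0"
  proof (rule ccontr)
    assume "\<not> t \<ge> 0"
    then have "(1 / - t) *\<^sub>R t *\<^sub>R e \<in> K" using \<open>\<not> t \<ge> 0\<close> by (intro scale[OF *]) simp
    then show False using \<open>\<not> t \<ge> 0\<close> neg_unit by simp
  qed
qed (rule scale[OF unit_in])

text \<open>Adding the element from \<open>absorbing\<close> cancels x and leaves a multiple of e,
  whose coefficient must be nonnegative by \<open>neg_unit\<close>. Hence the infimum defining the
  gauge is finite.\<close>

lemma order_gauge_bound:
  assumes "t *\<^sub>R e - x \<in> K"
  shows "- (norm x / r) \<le> t"
proof -
  have "(t + norm x / r) *\<^sub>R e \<in> K"
    using add[OF assms absorbing[of x]] by (simp add: algebra_simps)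
  then show ?thesis unfolding unit_scale_in_iff by simp
qed

lemma order_gauge_le: "t *\<^sub>R e - x \<in> K \<Longrightarrow> order_gauge x \<le> t"
  unfolding order_gauge_def using order_gauge_bound
  by (intro cInf_lower) (auto intro!: bdd_belowI)

lemma order_gauge_greatest:
  assumes "\<And>t. t *\<^sub>R e - x \<in> K \<Longrightarrow> m \<le> t"
  shows "m \<le> order_gauge x"
  unfolding order_gauge_def
proof (rule cInf_greatest)
  show "{t. t *\<^sub>R e - x \<in> K} \<noteq> {}" using absorbing[of "- x"] by auto
qed (use assms in auto)

lemma order_gauge_sublinear: "sublinear order_gauge"
  unfolding sublinear_def
proof (intro conjI allI impI)
  fix x y
  have "order_gauge (x + y) - t \<le> order_gauge y" if "t *\<^sub>R e - x \<in> K" for t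
  proof (rule order_gauge_greatest)
    fix s assume "s *\<^sub>R e - y \<in> K"
    from add[OF that this] show "order_gauge (x + y) - t \<le> s"
      using order_gauge_le[of "t + s" "x + y"] by (simp add: algebra_simps)
  qed
  then have "order_gauge (x + y) - order_gauge y \<le> order_gauge x"
    by (intro order_gauge_greatest) (simp add: algebra_simps)
  then show "order_gauge (x + y) \<le> order_gauge x + order_gauge y" by simp
next
  fix c :: real and x assume c: "c \<ge> 0"
  have le: "order_gauge (c *\<^sub>R x) \<le> c * t" if "t *\<^sub>R e - x \<in> K" for t
    using scale[OF that c] by (intro order_gauge_le) (simp add: algebra_simps)
  show "order_gauge (c *\<^sub>R x) \<le> c * order_gauge x"
  proof (cases "c = 0")
    case True
    then show ?thesis using le[OF absorbing[of "- x", simplified]] by simp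
  next
    case False
    then have "c > 0" using c by simp
    have "order_gauge (c *\<^sub>R x) / c \<le> order_gauge x"
      using le \<open>c > 0\<close> by (intro order_gauge_greatest) (simp add: field_simps)
    then show ?thesis using \<open>c > 0\<close> by (simp add: field_simps)
  qed
qed

text \<open>If the gauge were at most 0, then t e - y would lie in K for every t > 0. Letting t tend
  to 0 gives -y in K, since K is closed.\<close>

lemma order_gauge_pos:
  assumes "- y \<notin> K"
  shows "order_gauge y > 0"
proof (rule ccontr)
  assume "\<not> order_gauge y > 0"
  have "t *\<^sub>R e - y \<in> K" if "t > 0" for t
  proof -
    obtain s where s: "s *\<^sub>R e - y \<in> K" "s < t"
      using order_gauge_greatest[of y t] \<open>\<not> order_gauge y > 0\<close> \<open>t > 0\<close> by force
    show ?thesis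
      using add[OF s(1) scale[OF unit_in, of "t - s"]] s(2) by (simp add: algebra_simps)
  qed
  then have "inverse (real (Suc n)) *\<^sub>R e - y \<in> K" for n by simp
  moreover have "(\<lambda>n. inverse (real (Suc n)) *\<^sub>R e - y) \<longlonglongrightarrow> 0 *\<^sub>R e - y"
    by (intro tendsto_intros LIMSEQ_inverse_real_of_nat)
  ultimately show False
    using closed assms closed_sequentially[of K] by fastforce
qed

text \<open>Take f below the gauge and equal to it at y. For x in K the gauge of -x is at most 0, so
  f is positive; the gauge is at most 1 at e and at most -1 at -e, which pins f(e) = 1.\<close>

lemma positive_functional_exists:
  assumes "- y \<notin> K"
  obtains f :: "'a dual" where "f \<in> dual_cone K" "blinfun_apply f e = 1" "blinfun_apply f y > 0"
proof -
  obtain f where f: "linear f" "\<And>x. f x \<le> order_gauge x" "f y = order_gauge y"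
    using Hahn_Banach_sublinear[OF order_gauge_sublinear] by blast
  have pos: "f x \<ge> 0" if "x \<in> K" for x
    using f(2)[of "- x"] order_gauge_le[of 0 "- x"] that by (simp add: linear_neg[OF f(1)])
  have "f e = 1"
    using f(2)[of e] f(2)[of "- e"] order_gauge_le[of 1 e] order_gauge_le[of "- 1" "- e"]
      scale[OF unit_in, of 0]
    by (simp add: linear_neg[OF f(1)])
  have "bounded_linear f"
    using positive_functional_bound[OF f(1) pos] linear_add[OF f(1)] linear_scale[OF f(1)]
    by (intro bounded_linear_intro[of f "f e / r"]) (auto simp: mult.commute)
  then have "blinfun_apply (Blinfun f) = f" by (rule bounded_linear_Blinfun_apply)
  with pos \<open>f e = 1\<close> order_gauge_pos[OF assms] f(3) show ?thesis
    by (intro that[of "Blinfun f"]) (auto simp: dual_cone_def)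
qed

section \<open>Weak-star compactness of slices of the dual cone\<close>

definition slice :: "real set \<Rightarrow> 'a dual set"
  where "slice T = {f \<in> dual_cone K. blinfun_apply f e \<in> T}"

lemma dual_cone_bound:
  assumes "f \<in> dual_cone K"
  shows "\<bar>blinfun_apply f x\<bar> \<le> blinfun_apply f e * norm x / r"
proof (rule positive_functional_bound)
  show "linear (blinfun_apply f)"
    by (rule bounded_linear.linear[OF blinfun.bounded_linear_right])
qed (use assms in \<open>simp add: dual_cone_def\<close>)

lemma dual_cone_eq_0: "f \<in> dual_cone K \<Longrightarrow> blinfun_apply f e = 0 \<Longrightarrow> f = 0"
  using dual_cone_bound[of f] by (intro blinfun_eqI) simp

lemma dual_cone_scale: "f \<in> dual_cone K \<Longrightarrow> c \<ge> 0 \<Longrightarrow> c *\<^sub>R f \<in> dual_cone K"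
  by (simp add: dual_cone_def blinfun.scaleR_left)

lemma convex_slice: "convex T \<Longrightarrow> convex (slice T)"
  by (simp add: convex_def slice_def dual_cone_def blinfun.add_left blinfun.scaleR_left)

text \<open>Banach--Alaoglu: \<open>slice T\<close> is the image of a closed subset of a product of compact intervals.\<close>
lemma compactin_slice:
  assumes T: "compact T"
  shows "compactin weak_star (slice T)"
proof -
  obtain b where b: "\<And>t. t \<in> T \<Longrightarrow> t \<le> b"
    using compact_imp_bounded[OF T] bounded_imp_bdd_above unfolding bdd_above_def by blast
  define M where "M = blinfun_apply ` slice T"
  \<comment> \<open>The radii come from \<open>dual_cone_bound\<close>, with b bounding the
    admissible values at e.\<close>
  define Q where "Q = (\<Pi>\<^sub>E x\<in>(UNIV :: 'a set). {- (b * norm x / r)..b * norm x / r})"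
  \<comment> \<open>Each condition involves finitely many coordinates and is closed under pointwise
    limits. Boundedness is left out here; it is recovered from the box Q.\<close>
  define L where "L = {\<phi>::'a \<Rightarrow> real. (\<forall>x y. \<phi> (x + y) = \<phi> x + \<phi> y) \<and>
    (\<forall>c x. \<phi> (c *\<^sub>R x) = c * \<phi> x) \<and> (\<forall>x\<in>K. \<phi> x \<ge> 0) \<and> \<phi> e \<in> T}"
  have "compactin (product_topology (\<lambda>_. euclidean) UNIV) Q"
    unfolding Q_def by (subst compactin_PiE) auto
  then have "compact Q" by (simp add: euclidean_product_topology)
  have cont: "continuous_on UNIV (\<lambda>\<phi>::'a \<Rightarrow> real. \<phi> x)" for x
    by (rule continuous_on_product_coordinates)
  have "closed {\<phi>::'a \<Rightarrow> real. \<phi> e \<in> T}"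
    using closed_vimage[OF compact_imp_closed[OF T] cont[of e]] by (simp add: vimage_def)
  then have "closed L"
    unfolding L_def Ball_def
    by (intro closed_Collect_conj closed_Collect_all closed_Collect_imp open_Collect_const
        closed_Collect_eq closed_Collect_le continuous_intros cont)
  have "M = Q \<inter> L"
  proof (intro equalityI subsetI)
    fix \<phi> assume "\<phi> \<in> M"
    then obtain f where f: "\<phi> = blinfun_apply f" "f \<in> dual_cone K" "blinfun_apply f e \<in> T"
      by (auto simp: M_def slice_def)
    have "\<bar>\<phi> x\<bar> \<le> b * norm x / r" for x
    proof -
      have "blinfun_apply f e * norm x / r \<le> b * norm x / r"
        using b[OF f(3)] r by (intro divide_right_mono mult_right_mono) auto
      then show ?thesis using dual_cone_bound[OF f(2), of x] f(1) by simp
    qed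
    with f show "\<phi> \<in> Q \<inter> L"
      by (auto simp: Q_def L_def abs_le_iff dual_cone_def blinfun.add_right blinfun.scaleR_right
          minus_le_iff)
  next
    fix \<phi> assume *: "\<phi> \<in> Q \<inter> L"
    have "\<bar>\<phi> x\<bar> \<le> norm x * (b / r)" for x
      using * by (auto simp: Q_def PiE_iff abs_le_iff mult.commute minus_le_iff)
    then have "bounded_linear \<phi>"
      using * by (intro bounded_linear_intro[of \<phi> "b / r"]) (auto simp: L_def)
    then have "blinfun_apply (Blinfun \<phi>) = \<phi>" by (rule bounded_linear_Blinfun_apply)
    then show "\<phi> \<in> M"
      using * unfolding M_def
      by (intro image_eqI[of _ _ "Blinfun \<phi>"]) (auto simp: L_def slice_def dual_cone_def)
  qed
  then have "compactin (top_of_set M) M"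
    using compact_Int_closed[OF \<open>compact Q\<close> \<open>closed L\<close>] by simp
  \<comment> \<open>Back to the dual: weak-star continuity is tested pointwise, and on M
    \<open>Blinfun\<close> inverts \<open>blinfun_apply\<close>.\<close>
  moreover have "continuous_map (top_of_set M) weak_star Blinfun"
    unfolding continuous_on_strong_operator_topo_iff_coordinatewise
  proof
    fix x
    have "continuous_on M (\<lambda>\<phi>. blinfun_apply (Blinfun \<phi>) x)"
      using continuous_on_subset[OF cont[of x]]
      by (rule continuous_on_eq[where f = "\<lambda>\<phi>. \<phi> x"]) (auto simp: M_def blinfun_apply_inverse)
    then show "continuous_map (top_of_set M) euclidean (\<lambda>\<phi>. blinfun_apply (Blinfun \<phi>) x)"
      by simp
  qed
  ultimately have "compactin weak_star (Blinfun ` M)" by (rule image_compactin)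
  moreover have "Blinfun ` M = slice T"
    by (simp add: M_def image_image blinfun_apply_inverse)
  ultimately show ?thesis by simp
qed

section \<open>The two slices as a scalarization pair\<close>

lemma slice_rescale:
  assumes "f \<in> slice {s}" "t \<ge> 0" "s > 0"
  shows "(t / s) *\<^sub>R f \<in> slice {t}"
  using assms by (simp add: slice_def dual_cone_scale blinfun.scaleR_left)

lemma slice_2_nonempty:
  obtains g where "g \<in> slice {2}"
proof -
  obtain f where "f \<in> dual_cone K" "blinfun_apply f e = 1"
    using positive_functional_exists[OF neg_unit] by blast
  then have "2 *\<^sub>R f \<in> slice {2}"
    by (simp add: slice_def dual_cone_scale blinfun.scaleR_left)
  then show ?thesis by (rule that)
qed

lemma half_slice: "g \<in> slice {2} \<Longrightarrow> t \<in> {0..1} \<Longrightarrow> (t / 2) *\<^sub>R g \<in> slice {0..1}"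
  by (auto simp: slice_def dual_cone_scale blinfun.scaleR_left)

text \<open>Thus H = [0, 1/2] G, which reduces maximization over H to maximization over G. A
  functional with value 0 at e is zero and singles out no ray, so any g will do there.\<close>

lemma slice_cases:
  assumes "h \<in> slice {0..1}"
  obtains t g where "0 \<le> t" "t \<le> 1" "g \<in> slice {2}" "h = (t / 2) *\<^sub>R g"
proof (cases "blinfun_apply h e = 0")
  case True
  obtain g where "g \<in> slice {2}" by (rule slice_2_nonempty)
  moreover have "h = 0"
    using True assms dual_cone_eq_0 by (simp add: slice_def)
  ultimately show ?thesis using that[of 0 g] by simp
next
  case False
  define t where "t = blinfun_apply h e"
  have t: "0 < t" "t \<le> 1" using False assms by (auto simp: slice_def t_def)
  have "h \<in> slice {t}" using assms by (simp add: slice_def t_def)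
  then have "(2 / t) *\<^sub>R h \<in> slice {2}" using t by (intro slice_rescale) auto
  then show ?thesis using that[of t "(2 / t) *\<^sub>R h"] t by simp
qed

lemma slice_2_face_less:
  "set_less (dual_cone K) (face (slice {0..1}) y) (face (slice {2}) y)"
proof -
  let ?G = "slice {2}" and ?H = "slice {0..1}"
  have cG: "compactin weak_star ?G" and cH: "compactin weak_star ?H"
    by (auto intro: compactin_slice)
  have "face ?G y \<subseteq> face ?H y + dual_cone K"
  proof
    fix g assume "g \<in> face ?G y"
    then have g: "g \<in> ?G" and max: "\<And>g'. g' \<in> ?G \<Longrightarrow> blinfun_apply g' y \<le> blinfun_apply g y"
      by (auto simp: face_eq[OF cG])
    have gK: "g \<in> dual_cone K" using g by (simp add: slice_def)
    \<comment> \<open>The best factor t/2 in [0, 1/2] is 1/2 when the maximum of G at y is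
      nonnegative, and 0 otherwise.\<close>
    define c :: real where "c = (if blinfun_apply g y \<ge> 0 then 1 else 0)"
    have "(c / 2) *\<^sub>R g \<in> face ?H y"
      unfolding face_eq[OF cH]
    proof (intro CollectI conjI ballI)
      show "(c / 2) *\<^sub>R g \<in> ?H" using half_slice[OF g] by (simp add: c_def)
      fix h assume "h \<in> ?H"
      then obtain t g' where t: "0 \<le> t" "t \<le> 1" "g' \<in> ?G" "h = (t / 2) *\<^sub>R g'"
        by (rule slice_cases)
      have "blinfun_apply h y \<le> (t / 2) * blinfun_apply g y"
        using t max[of g'] by (simp add: blinfun.scaleR_left mult_left_mono)
      also have "\<dots> \<le> (c / 2) * blinfun_apply g y"
        using t by (auto simp: c_def mult_left_le_one_le mult_nonneg_nonpos)
      finally show "blinfun_apply h y \<le> blinfun_apply ((c / 2) *\<^sub>R g) y"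
        by (simp add: blinfun.scaleR_left)
    qed
    moreover have "(1 - c / 2) *\<^sub>R g \<in> dual_cone K"
      using gK by (intro dual_cone_scale) (auto simp: c_def)
    moreover have "g = (c / 2) *\<^sub>R g + (1 - c / 2) *\<^sub>R g"
      by (simp add: algebra_simps)
    ultimately show "g \<in> face ?H y + dual_cone K" by (metis set_plus_intro)
  qed
  moreover have "face ?H y \<subseteq> face ?G y + uminus ` dual_cone K"
  proof
    fix h assume "h \<in> face ?H y"
    then have h: "h \<in> ?H" and max: "\<And>h'. h' \<in> ?H \<Longrightarrow> blinfun_apply h' y \<le> blinfun_apply h y"
      by (auto simp: face_eq[OF cH])
    obtain t g where t: "0 \<le> t" "t \<le> 1" "g \<in> ?G" "h = (t / 2) *\<^sub>R g"
      using h by (rule slice_cases)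
    \<comment> \<open>For t > 0, comparing h with (t/2) g' for the same t shows that g maximizes
      over G. For t = 0 we have h = 0, and any maximizer can replace g.\<close>
    obtain g0 where g0: "g0 \<in> face ?G y" "h = (t / 2) *\<^sub>R g0"
    proof (cases "t = 0")
      case True
      have "face ?G y \<noteq> {}" using t(3) by (intro face_nonempty[OF cG]) auto
      then show ?thesis using that True t(4) by auto
    next
      case False
      have "blinfun_apply g' y \<le> blinfun_apply g y" if "g' \<in> ?G" for g'
        using max[OF half_slice[OF that, of t]] t False by (simp add: blinfun.scaleR_left)
      then show ?thesis using that[of g] t by (simp add: face_eq[OF cG])
    qed
    have "(1 - t / 2) *\<^sub>R g0 \<in> dual_cone K"
      using g0(1) t by (intro dual_cone_scale) (auto simp: face_def slice_def)
    moreover have "h = g0 + - ((1 - t / 2) *\<^sub>R g0)"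
      by (simp add: g0(2) algebra_simps)
    ultimately show "h \<in> face ?G y + uminus ` dual_cone K"
      using g0(1) by (metis imageI set_plus_intro)
  qed
  ultimately show ?thesis by (simp add: set_less_def lower_less_def upper_less_def)
qed

lemma pos_in_interior_pos_halfspace:
  fixes f :: "'a dual"
  assumes "blinfun_apply f y > 0"
  shows "f \<in> interior (pos_halfspace y)"
proof (rule interiorI)
  show "open {f :: 'a dual. 0 < blinfun_apply f y}"
    by (intro open_Collect_less continuous_on_const linear_continuous_on blinfun.bounded_linear_left)
qed (use assms in \<open>auto simp: pos_halfspace_def\<close>)

text \<open>A maximizer g0 of G at y has a positive value there, by
  \<open>positive_functional_exists\<close>. Members of H reach at most half of that value, so g0 -
  h is strictly positive at y.\<close>

lemma slice_strict_less:
  assumes "y \<notin> uminus ` K"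
  shows "slice {0..1} \<subseteq> slice {2} + uminus ` interior (pos_halfspace y)"
proof
  fix h assume "h \<in> slice {0..1}"
  then obtain t g where t: "0 \<le> t" "t \<le> 1" "g \<in> slice {2}" "h = (t / 2) *\<^sub>R g"
    by (rule slice_cases)
  have "- y \<notin> K" using assms by (metis imageI minus_minus)
  then obtain f where f: "f \<in> dual_cone K" "blinfun_apply f e = 1" "blinfun_apply f y > 0"
    by (rule positive_functional_exists)
  have "2 *\<^sub>R f \<in> slice {2}"
    using f by (simp add: slice_def dual_cone_scale blinfun.scaleR_left)
  have cG: "compactin weak_star (slice {2})" by (auto intro: compactin_slice)
  have "face (slice {2}) y \<noteq> {}"
    using t(3) by (intro face_nonempty[OF cG]) auto
  then obtain g0 where g0: "g0 \<in> face (slice {2}) y" by blast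
  then have max: "\<And>g'. g' \<in> slice {2} \<Longrightarrow> blinfun_apply g' y \<le> blinfun_apply g0 y"
    by (simp add: face_eq[OF cG])
  have pos: "blinfun_apply g0 y > 0"
    using max[OF \<open>2 *\<^sub>R f \<in> slice {2}\<close>] f(3) by (simp add: blinfun.scaleR_left)
  have "blinfun_apply h y \<le> (t / 2) * blinfun_apply g0 y"
    using t max[of g] by (simp add: blinfun.scaleR_left mult_left_mono)
  also have "\<dots> < blinfun_apply g0 y"
    using t pos by simp
  finally have "g0 - h \<in> interior (pos_halfspace y)"
    by (intro pos_in_interior_pos_halfspace) (simp add: blinfun.diff_left)
  moreover have "g0 \<in> slice {2}" using g0 by (simp add: face_def)
  moreover have "h = g0 + - (g0 - h)" by simp
  ultimately show "h \<in> slice {2} + uminus ` interior (pos_halfspace y)"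
    by (metis imageI set_plus_intro)
qed

lemma scalarization_pair_slice: "scalarization_pair K (slice {2}) (slice {0..1})"
proof -
  obtain g where g: "g \<in> slice {2}" by (rule slice_2_nonempty)
  moreover have "slice {0..1} \<noteq> {}" using half_slice[OF g, of 0] by auto
  moreover have "slice {0..1} \<inter> slice {2} = {}" by (auto simp: slice_def)
  ultimately show ?thesis
    unfolding scalarization_pair_def
    using slice_2_face_less slice_strict_less
    by (auto intro!: convex_slice compactin_slice)
qed

section \<open>Values at the unit, and separation from support functions of generators\<close>

lemma supp_fun_slice_2: "supp_fun (slice {2}) (c *\<^sub>R e) = 2 * c"
proof -
  obtain g where "g \<in> slice {2}" by (rule slice_2_nonempty)
  then show ?thesis
    by (subst supp_fun_eqI[of g]) (auto simp: slice_def blinfun.scaleR_right)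
qed

lemma supp_fun_slice_unit:
  "supp_fun (slice {0..1}) e = 1" "supp_fun (slice {0..1}) (- e) = 0"
proof -
  obtain g where g: "g \<in> slice {2}" by (rule slice_2_nonempty)
  show "supp_fun (slice {0..1}) e = 1"
    using g half_slice[OF g, of 1]
    by (subst supp_fun_eqI[of "(1 / 2) *\<^sub>R g"]) (auto simp: slice_def blinfun.scaleR_left)
  show "supp_fun (slice {0..1}) (- e) = 0"
    using half_slice[OF g, of 0]
    by (subst supp_fun_eqI[of 0]) (auto simp: slice_def blinfun.minus_right)
qed

lemma Omega_QD_Diff_Omega_DS: "Omega_QD K - Omega_DS K \<noteq> {}"
proof -
  define \<Psi> where "\<Psi> y = supp_fun (slice {2}) y - supp_fun (slice {0..1}) y" for y
  have "\<Psi> \<in> Omega_QD K"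
    using scalarization_pair_slice unfolding Omega_QD_def \<Psi>_def by blast
  moreover have "\<Psi> \<notin> Omega_DS K"
  proof
    assume "\<Psi> \<in> Omega_DS K"
    then obtain C where C: "compactin weak_star C" "generator K C" "\<Psi> = supp_fun C"
      by (auto simp: Omega_DS_def)
    \<comment> \<open>A generator is nonempty, because the cone it generates contains g.\<close>
    obtain g where "g \<in> slice {2}" by (rule slice_2_nonempty)
    then have "g \<in> {t *\<^sub>R f | t f. t \<ge> 0 \<and> f \<in> C}"
      using C(2) unfolding generator_def slice_def by blast
    then obtain f where "f \<in> C" by blast
    have "\<Psi> e = 1" "\<Psi> (- e) = - 2"
      using supp_fun_slice_2[of 1] supp_fun_slice_2[of "- 1"] supp_fun_slice_unit
      by (simp_all add: \<Psi>_def)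
    \<comment> \<open>The two bounds for f read f(e) <= 1 and -f(e) <= -2.\<close>
    then show False
      using supp_fun_upper[OF C(1) \<open>f \<in> C\<close>, of e] supp_fun_upper[OF C(1) \<open>f \<in> C\<close>, of "- e"] C(3)
      by (simp add: blinfun.minus_right)
  qed
  ultimately show ?thesis by blast
qed

end

theorem theorem5p9:
  fixes K :: "'a::banach set"
  assumes "\<exists>y::'a. y \<noteq> 0"
    and "closed K" and "convex K" and "cone K" and "pointed K"
    and "interior K \<noteq> {}"
    and "interior (dual_cone K) \<noteq> {}"
  shows "Omega_QD K - Omega_DS K \<noteq> {}"
proof -
  have add: "x + y \<in> K" if "x \<in> K" "y \<in> K" for x y
    using assms(3,4) that convex_cone[of K] by blast
  have scale: "c *\<^sub>R x \<in> K" if "x \<in> K" "c \<ge> 0" for x c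
    using assms(4) that by (simp add: cone_def)
  obtain e r where r: "r > 0" "cball e r \<subseteq> K"
    using assms(6) by (auto simp: mem_interior_cball)
  \<comment> \<open>Otherwise translating the ball by -e puts a ball around 0 into K, so K is the
    whole space; pointedness then makes the space trivial.\<close>
  have "- e \<notin> K"
  proof
    assume "- e \<in> K"
    have "x \<in> K" for x
    proof -
      \<comment> \<open>The denominator norm x + 1 covers x = 0 without a case split.\<close>
      have "e + (r / (norm x + 1)) *\<^sub>R x \<in> K"
      proof (rule subsetD[OF r(2)])
        have "r * norm x \<le> r * (norm x + 1)" using r(1) by simp
        moreover have "norm x + 1 > 0" using norm_ge_zero[of x] by linarith
        ultimately have "r * norm x / (norm x + 1) \<le> r" by (simp add: pos_divide_le_eq)
        then show "e + (r / (norm x + 1)) *\<^sub>R x \<in> cball e r"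
          using r(1) by (simp add: dist_norm)
      qed
      from add[OF this \<open>- e \<in> K\<close>] have "(r / (norm x + 1)) *\<^sub>R x \<in> K" by simp
      moreover have "norm x + 1 > 0" using norm_ge_zero[of x] by linarith
      ultimately show ?thesis
        using scale[of "(r / (norm x + 1)) *\<^sub>R x" "(norm x + 1) / r"] r(1) by simp
    qed
    then have "x \<in> K \<inter> uminus ` K" for x
      by (metis IntI imageI minus_minus)
    then show False using assms(1,5) unfolding pointed_def by blast
  qed
  then interpret solid_cone K e r
    using assms(2) add scale r by unfold_locales
  show ?thesis by (rule Omega_QD_Diff_Omega_DS)
qed

end
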